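(* Let $\alpha<\beta$ be real numbers, and let a finite family of gates be given, i.e., finitely many vertical segments $\{x_i\}\times[m_i,M_i]$ in the plane, $i=1,\dots,n$, with $x_i,m_i,M_i\in\mathbb{R}$ and $m_i\le M_i$. For $(x,y)\in\mathbb{R}^2$ let $t(x,y)$ be the minimal number of gates crossed by a player who starts at $(x,y)$ and moves to the right with slope always between $\alpha$ and $\beta$, and let $T(x)=\max_{y\in\mathbb{R}} t(x,y)$. Then $$\int_{\mathbb{R}} T(x)\,dx\le \frac{1}{\beta-\alpha}\sum_{i=1}^n (M_i-m_i).$$
   Context: A trajectory of the player starting at $(x,y)$ with slope between $\alpha$ and $\beta$ is the graph of a function $f:[x,\infty)\to\mathbb{R}$ with $f(x)=y$ and $\alpha(v-u)\le f(v)-f(u)\le\beta(v-u)$ for all $x\le u\le v$. The trajectory crosses the $i$th gate if $x_i\ge x$ and $f(x_i)\in[m_i,M_i]$. The number $t(x,y)$ is the minimum, over all such trajectories starting at $(x,y)$, of the number of indices $i$ such that the $i$th gate is crossed. (Gates to the left of the starting point do not matter.) *)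

theory Defs
  imports "HOL-Analysis.Analysis"
begin

text \<open>The graph of a function on the half-line \<open>[x, \<infinity>)\<close> is represented by a total function
  of which only the values on \<open>{x..}\<close> are constrained (and, below, used).\<close>

definition trajectory :: "real \<Rightarrow> real \<Rightarrow> real \<Rightarrow> real \<Rightarrow> (real \<Rightarrow> real) \<Rightarrow> bool" where
  "trajectory \<alpha> \<beta> x y f \<longleftrightarrow>
     f x = y \<and> (\<forall>u v. x \<le> u \<and> u \<le> v \<longrightarrow> \<alpha> * (v - u) \<le> f v - f u \<and> f v - f u \<le> \<beta> * (v - u))"

text \<open>The \<open>i\<close>th gate, \<open>1 \<le> i \<le> n\<close>, is \<open>{xs i} \<times> {m i..M i}\<close>. Gates are counted with
  multiplicity: the crossed indices are counted, not the crossed segments.\<close>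

definition crossed ::
  "nat \<Rightarrow> (nat \<Rightarrow> real) \<Rightarrow> (nat \<Rightarrow> real) \<Rightarrow> (nat \<Rightarrow> real) \<Rightarrow> real \<Rightarrow> (real \<Rightarrow> real) \<Rightarrow> nat set" where
  "crossed n xs m M x f = {i \<in> {1..n}. x \<le> xs i \<and> f (xs i) \<in> {m i..M i}}"

definition min_crossed ::
  "real \<Rightarrow> real \<Rightarrow> nat \<Rightarrow> (nat \<Rightarrow> real) \<Rightarrow> (nat \<Rightarrow> real) \<Rightarrow> (nat \<Rightarrow> real) \<Rightarrow> real \<Rightarrow> real \<Rightarrow> nat" where
  "min_crossed \<alpha> \<beta> n xs m M x y = Min {card (crossed n xs m M x f) | f. trajectory \<alpha> \<beta> x y f}"

definition max_min_crossed ::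
  "real \<Rightarrow> real \<Rightarrow> nat \<Rightarrow> (nat \<Rightarrow> real) \<Rightarrow> (nat \<Rightarrow> real) \<Rightarrow> (nat \<Rightarrow> real) \<Rightarrow> real \<Rightarrow> nat" where
  "max_min_crossed \<alpha> \<beta> n xs m M x = Max (range (min_crossed \<alpha> \<beta> n xs m M x))"

text \<open>The sets under \<^const>\<open>Min\<close> and \<^const>\<open>Max\<close> are finite and nonempty, so the extrema are
  genuine.\<close>

lemma card_crossed_le: "card (crossed n xs m M x f) \<le> n"
proof -
  have "crossed n xs m M x f \<subseteq> {1..n}"
    by (auto simp: crossed_def)
  from card_mono[OF _ this] show ?thesis by simp
qed

lemma finite_card_crossed:
  "finite {card (crossed n xs m M x f) | f. trajectory \<alpha> \<beta> x y f}"
  by (rule finite_subset[of _ "{..n}"]) (auto intro: card_crossed_le)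

lemma card_crossed_nonempty:
  assumes "\<alpha> < \<beta>"
  shows "{card (crossed n xs m M x f) | f. trajectory \<alpha> \<beta> x y f} \<noteq> {}"
proof -
  have "\<alpha> * (v - u) \<le> \<beta> * (v - u)" if "u \<le> v" for u v
    using assms that by (intro mult_right_mono) auto
  moreover have "(y + \<alpha> * (v - x)) - (y + \<alpha> * (u - x)) = \<alpha> * (v - u)" for u v
    by (simp add: algebra_simps)
  ultimately have "trajectory \<alpha> \<beta> x y (\<lambda>u. y + \<alpha> * (u - x))"
    unfolding trajectory_def by simp
  then show ?thesis by blast
qed

lemma min_crossed_le:
  assumes "\<alpha> < \<beta>"
  shows "min_crossed \<alpha> \<beta> n xs m M x y \<le> n"
proof -
  have "min_crossed \<alpha> \<beta> n xs m M x y
      \<in> {card (crossed n xs m M x f) | f. trajectory \<alpha> \<beta> x y f}"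
    unfolding min_crossed_def by (rule Min_in[OF finite_card_crossed card_crossed_nonempty[OF assms]])
  then show ?thesis
    using card_crossed_le by force
qed

lemma finite_range_min_crossed:
  assumes "\<alpha> < \<beta>"
  shows "finite (range (min_crossed \<alpha> \<beta> n xs m M x))"
  by (rule finite_subset[of _ "{..n}"]) (auto intro: min_crossed_le[OF assms])

end

theory Submission
  imports Defs
begin

text \<open>
  Consider, for a fixed abscissa \<open>x\<close>, the area \<open>\<Phi> x = \<integral> t(x, y) dy\<close> under \<open>t\<close>, and
  move \<open>x\<close> from right to left. To the right of all gates \<open>\<Phi>\<close> vanishes. Passing a gate
  \<open>[m, M]\<close> adds the indicator function of \<open>[m, M]\<close> to \<open>t(x, \<cdot>)\<close>, hence exactly
  \<open>M - m\<close> to \<open>\<Phi>\<close> (\<open>min_crossings_insert_at\<close>). Between gates \<open>\<Phi>\<close> shrinks, and it does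
  so at a rate of at least \<open>(\<beta> - \<alpha>) T(x)\<close>. Since \<open>\<Phi>\<close> can never become negative, the
  total loss \<open>(\<beta> - \<alpha>) \<integral> T\<close> is at most the total gain \<open>\<Sum> (M\<^sub>i - m\<^sub>i)\<close>.

  For the rate of loss, let \<open>A\<^sub>k(x) = {y. k \<le> t(x, y)}\<close>, so that
  \<open>\<Phi> x = \<Sum>\<^sub>k |A\<^sub>k(x)|\<close> and \<open>T(x)\<close> is the number of \<open>k \<ge> 1\<close> with \<open>A\<^sub>k(x) \<noteq> {}\<close>.
  Before any gate, over a distance \<open>d\<close>, the player may reach exactly the ordinates in
  \<open>y + [\<alpha>d, \<beta>d]\<close>, and so \<open>y \<in> A\<^sub>k(x)\<close> iff this whole interval lies in \<open>A\<^sub>k(x + d)\<close>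
  (\<open>le_min_crossings_iff_later\<close>): moving left erodes the level sets. In particular
  \<open>A\<^sub>k(x) + [\<alpha>d, \<beta>d] \<subseteq> A\<^sub>k(x + d)\<close>, and the one-dimensional Brunn-Minkowski inequality
  (\<open>emeasure_add_interval_le\<close>) shows that a level set that is still nonempty has lost at
  least \<open>(\<beta> - \<alpha>) d\<close> of its length. Summing over \<open>k\<close> gives \<open>integral_decrease_to_left\<close>.

  The gates are added by induction from right to left, which keeps every new gate to the left
  of the old ones and treats gates with equal abscissae one after the other
  (\<open>integral_right_of_le_heights\<close>). Regularity comes along with the same induction: for
  \<open>k \<ge> 1\<close> the sets \<open>A\<^sub>k(x)\<close> are compact, because erosion is an intersection of translates,
  and \<open>T\<close> is Borel because it increases on each interval free of gates.
\<close>

section \<open>Integrals by layers and lengths of sum sets\<close>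

lemma nn_integral_nat_layers:
  fixes f :: "'a \<Rightarrow> nat"
  assumes bound: "\<And>x. f x \<le> N"
    and meas: "\<And>k. 1 \<le> k \<Longrightarrow> S \<inter> {x. k \<le> f x} \<in> sets M"
  shows "(\<integral>\<^sup>+x\<in>S. of_nat (f x) \<partial>M) = (\<Sum>k=1..N. emeasure M (S \<inter> {x. k \<le> f x}))"
proof -
  have "of_nat (f x) * indicator S x = (\<Sum>k=1..N. indicator (S \<inter> {x. k \<le> f x}) x :: ennreal)" for x
  proof -
    have "(\<Sum>k=1..N. indicator {x. k \<le> f x} x :: ennreal) = (\<Sum>k=1..N. if k \<in> {1..f x} then 1 else 0)"
      by (intro sum.cong) auto
    also have "\<dots> = (\<Sum>k \<in> {1..N} \<inter> {1..f x}. 1)"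
      by (rule sum.inter_restrict[symmetric]) simp
    also have "{1..N} \<inter> {1..f x} = {1..f x}"
      using bound[of x] by auto
    finally have "of_nat (f x) = (\<Sum>k=1..N. indicator {x. k \<le> f x} x :: ennreal)"
      by simp
    then show ?thesis
      by (simp add: indicator_inter_arith sum_distrib_left mult.commute)
  qed
  then have "(\<integral>\<^sup>+x\<in>S. of_nat (f x) \<partial>M)
      = (\<integral>\<^sup>+x. (\<Sum>k=1..N. indicator (S \<inter> {x. k \<le> f x}) x) \<partial>M)"
    by simp
  also have "\<dots> = (\<Sum>k=1..N. emeasure M (S \<inter> {x. k \<le> f x}))"
    by (subst nn_integral_sum) (use meas in auto)
  finally show ?thesis .
qed

lemma emeasure_lborel_translation:
  fixes A :: "real set"
  assumes "A \<in> sets borel"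
  shows "emeasure lborel ((\<lambda>y. y - p) -` A) = emeasure lborel A"
proof -
  have "emeasure lborel A = emeasure (distr lborel borel ((+) (- p))) A"
    by (simp add: lborel_distr_plus)
  also have "\<dots> = emeasure lborel ((+) (- p) -` A \<inter> space lborel)"
    using assms by (intro emeasure_distr) auto
  also have "(+) (- p) -` A \<inter> space lborel = (\<lambda>y. y - p) -` A"
    by (auto simp: algebra_simps)
  finally show ?thesis by simp
qed

text \<open>The Brunn-Minkowski inequality on the line, for a compact set and an interval: the sum
  set contains the translate of \<open>A\<close> by the left endpoint \<open>p\<close> and, beyond it, the translate of
  \<open>{p<..q}\<close> by the maximum of \<open>A\<close>.\<close>

lemma emeasure_add_interval_le:
  fixes A B :: "real set"
  assumes "compact A" "A \<noteq> {}" "p \<le> q" "B \<in> sets borel"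
    and sum_subset: "\<And>a s. a \<in> A \<Longrightarrow> s \<in> {p..q} \<Longrightarrow> a + s \<in> B"
  shows "ennreal (q - p) + emeasure lborel A \<le> emeasure lborel B"
proof -
  obtain a where a: "a \<in> A" and max: "\<And>y. y \<in> A \<Longrightarrow> y \<le> a"
    using compact_attains_sup[OF assms(1,2)] by blast
  define A' where "A' = (\<lambda>y. y - p) -` A"
  have A_borel: "A \<in> sets borel"
    using \<open>compact A\<close> by (simp add: borel_compact)
  have A'_borel: "A' \<in> sets borel"
    using measurable_sets[of "\<lambda>y. y - p" borel borel A] A_borel by (simp add: A'_def)
  have disjoint: "{a + p<..a + q} \<inter> A' = {}"
    using max by (force simp: A'_def)
  have "ennreal (q - p) + emeasure lborel A = emeasure lborel {a + p<..a + q} + emeasure lborel A'"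
    using \<open>p \<le> q\<close> emeasure_lborel_translation[OF A_borel] by (simp add: A'_def)
  also have "\<dots> = emeasure lborel ({a + p<..a + q} \<union> A')"
    using A'_borel disjoint by (intro plus_emeasure) auto
  also have "\<dots> \<le> emeasure lborel B"
  proof (rule emeasure_mono)
    have "y \<in> B" if "y \<in> {a + p<..a + q}" for y
      using sum_subset[OF a, of "y - a"] that by auto
    moreover have "y \<in> B" if "y \<in> A'" for y
      using sum_subset[of "y - p" p] that \<open>p \<le> q\<close> by (auto simp: A'_def)
    ultimately show "{a + p<..a + q} \<union> A' \<subseteq> B" by blast
  qed (use assms in simp)
  finally show ?thesis .
qed

section \<open>The game with an arbitrary set of gates\<close>

text \<open>The gates are indexed by an arbitrary set \<open>I\<close>, so that they can be added one at a time in
  the order of their abscissae, which need not be the order of their indices.\<close>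

locale gate_game =
  fixes \<alpha> \<beta> :: real and xs m M :: "nat \<Rightarrow> real"
  assumes slopes: "\<alpha> < \<beta>"
begin

definition crossings :: "nat set \<Rightarrow> real \<Rightarrow> (real \<Rightarrow> real) \<Rightarrow> nat" where
  "crossings I x f = card {i \<in> I. x \<le> xs i \<and> f (xs i) \<in> {m i..M i}}"

definition min_crossings :: "nat set \<Rightarrow> real \<Rightarrow> real \<Rightarrow> nat" where
  "min_crossings I x y = Min {crossings I x f | f. trajectory \<alpha> \<beta> x y f}"

definition max_min_crossings :: "nat set \<Rightarrow> real \<Rightarrow> nat" where
  "max_min_crossings I x = Max (range (min_crossings I x))"

lemma trajectory_exists: "\<exists>f. trajectory \<alpha> \<beta> x y f"
  using card_crossed_nonempty[OF slopes, of 0 xs m M x y] by blast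

lemma trajectory_append:
  assumes g: "trajectory \<alpha> \<beta> c y' g" and "x \<le> c"
    and y': "y' \<in> {y + \<alpha> * (c - x)..y + \<beta> * (c - x)}"
  obtains f where "trajectory \<alpha> \<beta> x y f" "\<And>u. c \<le> u \<Longrightarrow> f u = g u"
proof (cases "x = c")
  case True
  then show ?thesis using g y' that by auto
next
  case False
  with \<open>x \<le> c\<close> have "x < c" by simp
  define s where "s = (y' - y) / (c - x)"
  have s: "\<alpha> \<le> s" "s \<le> \<beta>" and y'_eq: "y' = y + s * (c - x)"
    using y' \<open>x < c\<close> by (auto simp: s_def field_simps)
  define f where "f = (\<lambda>u. if u < c then y + s * (u - x) else g u)"
  have f_left: "f u = y + s * (u - x)" if "u \<le> c" for u
    using that g y'_eq by (cases "u = c") (auto simp: f_def trajectory_def)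
  have slope_left: "\<alpha> * (v - u) \<le> f v - f u \<and> f v - f u \<le> \<beta> * (v - u)"
    if "u \<le> v" "v \<le> c" for u v
  proof -
    have "f v - f u = s * (v - u)"
      using that by (simp add: f_left algebra_simps)
    then show ?thesis using s that by (simp add: mult_right_mono)
  qed
  have slope_right: "\<alpha> * (v - u) \<le> f v - f u \<and> f v - f u \<le> \<beta> * (v - u)"
    if "c \<le> u" "u \<le> v" for u v
    using that g by (simp add: f_def trajectory_def)
  have "\<alpha> * (v - u) \<le> f v - f u \<and> f v - f u \<le> \<beta> * (v - u)" if "u \<le> v" for u v
  proof (cases "u \<le> c \<and> c \<le> v")
    case True
    have "e * (v - u) = e * (v - c) + e * (c - u)" for e :: real
      by (simp add: algebra_simps)
    with slope_left[of u c] slope_right[of c v] True show ?thesis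
      by (smt (verit))
  next
    case False
    then show ?thesis using slope_left[of u v] slope_right[of u v] that by linarith
  qed
  moreover have "f x = y" using \<open>x < c\<close> by (simp add: f_def)
  ultimately have "trajectory \<alpha> \<beta> x y f" by (simp add: trajectory_def)
  moreover have "f u = g u" if "c \<le> u" for u
    using that by (simp add: f_def)
  ultimately show ?thesis using that by blast
qed

lemma crossings_le_card: "finite I \<Longrightarrow> crossings I x f \<le> card I"
  unfolding crossings_def by (rule card_mono) auto

lemma le_min_crossings_iff:
  assumes "finite I"
  shows "k \<le> min_crossings I x y \<longleftrightarrow> (\<forall>f. trajectory \<alpha> \<beta> x y f \<longrightarrow> k \<le> crossings I x f)"
proof -
  have "finite {crossings I x f | f. trajectory \<alpha> \<beta> x y f}"
    by (rule finite_subset[of _ "{..card I}"]) (auto intro: crossings_le_card[OF assms])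
  moreover have "{crossings I x f | f. trajectory \<alpha> \<beta> x y f} \<noteq> {}"
    using trajectory_exists by blast
  ultimately show ?thesis
    unfolding min_crossings_def by (subst Min_ge_iff) auto
qed

lemma min_crossings_le_card: "finite I \<Longrightarrow> min_crossings I x y \<le> card I"
  using le_min_crossings_iff[of I "min_crossings I x y" x y] trajectory_exists[of x y]
    crossings_le_card[of I x] order_trans by blast

lemma le_max_min_crossings_iff:
  assumes "finite I"
  shows "k \<le> max_min_crossings I x \<longleftrightarrow> (\<exists>y. k \<le> min_crossings I x y)"
proof -
  have "finite (range (min_crossings I x))"
    by (rule finite_subset[of _ "{..card I}"]) (auto intro: min_crossings_le_card[OF assms])
  then show ?thesis
    unfolding max_min_crossings_def by (subst Max_ge_iff) auto
qed

lemma max_min_crossings_le_card: "finite I \<Longrightarrow> max_min_crossings I x \<le> card I"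
  using le_max_min_crossings_iff[of I "max_min_crossings I x" x] min_crossings_le_card[of I x]
    order_trans by blast

text \<open>The principle of dynamic programming: until \<open>c\<close> nothing can be crossed, and what happens
  from \<open>c\<close> on depends only on the ordinate reached there.\<close>

lemma le_min_crossings_iff_later:
  assumes "finite I" "x \<le> c" and gates: "\<And>i. i \<in> I \<Longrightarrow> c \<le> xs i"
  shows "k \<le> min_crossings I x y \<longleftrightarrow>
    (\<forall>s\<in>{\<alpha> * (c - x)..\<beta> * (c - x)}. k \<le> min_crossings I c (y + s))"
proof -
  have crossings_eq: "crossings I x f = crossings I c g" if "\<And>u. c \<le> u \<Longrightarrow> f u = g u" for f g
    unfolding crossings_def using gates that \<open>x \<le> c\<close>
    by (intro arg_cong[where f = card] Collect_cong) (metis order_trans)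
  show ?thesis
  proof (intro iffI ballI)
    fix s assume k: "k \<le> min_crossings I x y" and s: "s \<in> {\<alpha> * (c - x)..\<beta> * (c - x)}"
    have "k \<le> crossings I c g" if g: "trajectory \<alpha> \<beta> c (y + s) g" for g
    proof -
      obtain f where "trajectory \<alpha> \<beta> x y f" "\<And>u. c \<le> u \<Longrightarrow> f u = g u"
        using trajectory_append[OF g \<open>x \<le> c\<close>, of y] s by auto
      then show ?thesis
        using k crossings_eq[of f g] by (metis le_min_crossings_iff[OF \<open>finite I\<close>])
    qed
    then show "k \<le> min_crossings I c (y + s)"
      by (simp add: le_min_crossings_iff[OF \<open>finite I\<close>])
  next
    assume k: "\<forall>s\<in>{\<alpha> * (c - x)..\<beta> * (c - x)}. k \<le> min_crossings I c (y + s)"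
    have "k \<le> crossings I x f" if f: "trajectory \<alpha> \<beta> x y f" for f
    proof -
      have "f c - y \<in> {\<alpha> * (c - x)..\<beta> * (c - x)}"
        using f \<open>x \<le> c\<close> by (auto simp: trajectory_def)
      with k have "k \<le> min_crossings I c (f c)" by fastforce
      moreover have "trajectory \<alpha> \<beta> c (f c) f"
        using f \<open>x \<le> c\<close> by (auto simp: trajectory_def)
      ultimately show ?thesis
        using crossings_eq[of f f] by (auto simp: le_min_crossings_iff[OF \<open>finite I\<close>])
    qed
    then show "k \<le> min_crossings I x y"
      by (simp add: le_min_crossings_iff[OF \<open>finite I\<close>])
  qed
qed

section \<open>Passing a gate and moving left between gates\<close>

lemma slope_range: "x \<le> c \<Longrightarrow> \<alpha> * (c - x) \<le> \<beta> * (c - x)"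
  using slopes by (simp add: mult_right_mono)

lemma min_crossings_insert_right:
  assumes "xs i < x"
  shows "min_crossings (insert i I) x y = min_crossings I x y"
proof -
  have "crossings (insert i I) x f = crossings I x f" for f
    unfolding crossings_def using assms by (intro arg_cong[where f = card]) auto
  then show ?thesis by (simp add: min_crossings_def)
qed

lemma max_min_crossings_insert_right:
  "xs i < x \<Longrightarrow> max_min_crossings (insert i I) x = max_min_crossings I x"
  using min_crossings_insert_right[of i x I] by (simp add: max_min_crossings_def)

text \<open>Every trajectory starting on the abscissa of a gate has its fate at that gate decided by
  the starting ordinate alone.\<close>

lemma min_crossings_insert_at:
  assumes "finite I" "i \<notin> I"
  shows "min_crossings (insert i I) (xs i) y = min_crossings I (xs i) y + indicator {m i..M i} y"
    (is "?l = ?r")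
proof -
  have crossings_eq: "crossings (insert i I) (xs i) f = crossings I (xs i) f + indicator {m i..M i} y"
    if f: "trajectory \<alpha> \<beta> (xs i) y f" for f
  proof -
    let ?C = "{j \<in> I. xs i \<le> xs j \<and> f (xs j) \<in> {m j..M j}}"
    have "f (xs i) = y" using f by (simp add: trajectory_def)
    then have "{j \<in> insert i I. xs i \<le> xs j \<and> f (xs j) \<in> {m j..M j}}
        = (if y \<in> {m i..M i} then insert i ?C else ?C)"
      by auto
    then show ?thesis
      using assms by (simp add: crossings_def)
  qed
  have "k \<le> ?l \<longleftrightarrow> k \<le> ?r" for k
  proof -
    have "k \<le> ?l \<longleftrightarrow> (\<forall>f. trajectory \<alpha> \<beta> (xs i) y f \<longrightarrow>
        k - indicator {m i..M i} y \<le> crossings I (xs i) f)"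
      using assms(1) crossings_eq by (auto simp: le_min_crossings_iff le_diff_conv)
    also have "\<dots> \<longleftrightarrow> k - indicator {m i..M i} y \<le> min_crossings I (xs i) y"
      by (simp only: le_min_crossings_iff[OF assms(1)])
    also have "\<dots> \<longleftrightarrow> k \<le> ?r"
      by (rule le_diff_conv)
    finally show ?thesis .
  qed
  then show ?thesis by (meson order_antisym order_refl)
qed

text \<open>The level set at \<open>x\<close> is the erosion of the one at \<open>c\<close>, that is, the intersection of the
  translates of the latter by \<open>- s\<close> for all slope-admissible rises \<open>s\<close>.\<close>

lemma compact_level_later:
  assumes "finite I" "x \<le> c" and "\<And>i. i \<in> I \<Longrightarrow> c \<le> xs i"
    and compact: "compact {y. k \<le> min_crossings I c y}"
  shows "compact {y. k \<le> min_crossings I x y}"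
proof -
  let ?B = "{y. k \<le> min_crossings I c y}"
  have "{y. k \<le> min_crossings I x y} = (\<Inter>s\<in>{\<alpha> * (c - x)..\<beta> * (c - x)}. (+) (- s) ` ?B)"
    using le_min_crossings_iff_later[OF assms(1-3)] by (force simp: image_iff algebra_simps)
  moreover have "compact ((+) (- s) ` ?B)" for s
    by (rule compact_translation[OF compact])
  ultimately show ?thesis
    using slope_range[OF \<open>x \<le> c\<close>] by (auto intro!: compact_Inter)
qed

lemma compact_level:
  assumes "finite I" "1 \<le> k" "\<And>i. i \<in> I \<Longrightarrow> c \<le> xs i"
  shows "compact {y. k \<le> min_crossings I c y}"
  using assms
proof (induction I arbitrary: c k rule: finite_ranking_induct[where f = "\<lambda>i. - xs i"])
  case empty
  have "min_crossings {} c y = 0" for y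
    using min_crossings_le_card[of "{}"] by simp
  then show ?case using \<open>1 \<le> k\<close> by simp
next
  case (insert i I)
  show ?case
  proof (cases "i \<in> I")
    case True
    then show ?thesis using insert by (simp add: insert_absorb)
  next
    case False
    let ?A = "\<lambda>k. {y. k \<le> min_crossings I (xs i) y}"
    have "{y. k \<le> min_crossings (insert i I) (xs i) y} = ?A k \<union> (?A (k - 1) \<inter> {m i..M i})"
      using False insert.hyps(1) by (auto simp: min_crossings_insert_at split: split_indicator)
    moreover have "compact (?A k)"
      using insert by simp
    \<comment> \<open>For \<open>k = 1\<close> this is the level set of \<open>0\<close>, the whole line, which is not compact.\<close>
    moreover have "closed (?A (k - 1))"
    proof (cases "k = 1")
      case False
      then show ?thesis using insert by (intro compact_imp_closed insert.IH) auto
    qed simp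
    ultimately have "compact {y. k \<le> min_crossings (insert i I) (xs i) y}"
      by (simp add: compact_Un closed_Int_compact)
    then show ?thesis
      using insert by (intro compact_level_later[of "insert i I" c "xs i"]) auto
  qed
qed

text \<open>The loss of length of each level set. Nonemptiness at \<open>x\<close> is essential: a level set that
  has vanished loses nothing more.\<close>

lemma emeasure_level_later:
  assumes "finite I" "1 \<le> k" "x \<le> c" and gates: "\<And>i. i \<in> I \<Longrightarrow> c \<le> xs i"
    and nonempty: "k \<le> max_min_crossings I x"
  shows "ennreal ((\<beta> - \<alpha>) * (c - x)) + emeasure lborel {y. k \<le> min_crossings I x y}
    \<le> emeasure lborel {y. k \<le> min_crossings I c y}"
proof -
  have gates': "x \<le> xs i" if "i \<in> I" for i
    using gates[OF that] \<open>x \<le> c\<close> by linarith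
  have "ennreal (\<beta> * (c - x) - \<alpha> * (c - x)) + emeasure lborel {y. k \<le> min_crossings I x y}
    \<le> emeasure lborel {y. k \<le> min_crossings I c y}"
  proof (rule emeasure_add_interval_le)
    show "compact {y. k \<le> min_crossings I x y}"
      using assms gates' by (intro compact_level) auto
    show "{y. k \<le> min_crossings I x y} \<noteq> {}"
      using nonempty \<open>finite I\<close> by (simp add: le_max_min_crossings_iff)
    show "{y. k \<le> min_crossings I c y} \<in> sets borel"
      using assms by (intro borel_compact compact_level) auto
  qed (use slope_range[OF \<open>x \<le> c\<close>] le_min_crossings_iff_later[of I x c k] assms in auto)
  then show ?thesis by (simp add: algebra_simps)
qed

text \<open>A level set of the finite length \<open>L\<close> at \<open>c\<close> is used up after a distance of at most
  \<open>L / (\<beta> - \<alpha>)\<close> to the left.\<close>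

lemma level_extinct:
  assumes "finite I" "1 \<le> k" "x \<le> c" and gates: "\<And>i. i \<in> I \<Longrightarrow> c \<le> xs i"
    and nonempty: "k \<le> max_min_crossings I x"
    and L: "emeasure lborel {y. k \<le> min_crossings I c y} = ennreal L" "0 \<le> L"
  shows "c - L / (\<beta> - \<alpha>) \<le> x"
proof -
  have "ennreal ((\<beta> - \<alpha>) * (c - x)) + emeasure lborel {y. k \<le> min_crossings I x y} \<le> ennreal L"
    using emeasure_level_later[OF assms(1-5)] L by simp
  then have "ennreal ((\<beta> - \<alpha>) * (c - x)) \<le> ennreal L"
    by (meson add_increasing2 order_refl order_trans zero_le)
  then have "(\<beta> - \<alpha>) * (c - x) \<le> L"
    using \<open>0 \<le> L\<close> by simp
  then show ?thesis
    using slopes by (simp add: field_simps)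
qed

lemma emeasure_level_finite:
  assumes "finite I" "1 \<le> k" "\<And>i. i \<in> I \<Longrightarrow> c \<le> xs i"
  obtains L where "0 \<le> L" "emeasure lborel {y. k \<le> min_crossings I c y} = ennreal L"
proof -
  have "emeasure lborel {y. k \<le> min_crossings I c y} < \<infinity>"
    using compact_level[OF assms] by (rule emeasure_compact_finite)
  then show ?thesis
    using that[OF measure_nonneg emeasure_eq_ennreal_measure] by auto
qed

lemma max_min_crossings_mono:
  assumes "finite I" "x \<le> x'" "x' \<le> c" and gates: "\<And>i. i \<in> I \<Longrightarrow> c \<le> xs i"
  shows "max_min_crossings I x \<le> max_min_crossings I x'"
proof -
  have gates': "x' \<le> xs i" if "i \<in> I" for i
    using gates[OF that] \<open>x' \<le> c\<close> by linarith
  obtain y where "max_min_crossings I x \<le> min_crossings I x y"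
    using le_max_min_crossings_iff[OF \<open>finite I\<close>] by blast
  then have "max_min_crossings I x \<le> min_crossings I x' (y + \<alpha> * (x' - x))"
    using le_min_crossings_iff_later[OF assms(1,2) gates'] slope_range[OF \<open>x \<le> x'\<close>] by auto
  then show ?thesis
    using le_max_min_crossings_iff[OF \<open>finite I\<close>] by blast
qed

text \<open>Right of the leftmost gate \<open>i\<close> the function agrees with the one for the other gates. Left
  of it there is monotonicity, used for the function continued beyond \<open>xs i\<close> as a constant,
  which is monotone on the whole line.\<close>

lemma max_min_crossings_measurable:
  "finite I \<Longrightarrow> max_min_crossings I \<in> borel \<rightarrow>\<^sub>M count_space UNIV"
proof (induction I rule: finite_ranking_induct[where f = "\<lambda>i. - xs i"])
  case empty
  have "max_min_crossings {} = (\<lambda>x. 0)"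
    using max_min_crossings_le_card[of "{}"] by auto
  then show ?case by simp
next
  case (insert i I)
  let ?T = "max_min_crossings (insert i I)"
  have "mono (\<lambda>x. real (?T (min x (xs i))))"
    using insert by (intro monoI of_nat_mono max_min_crossings_mono[where c = "xs i"]) auto
  then have "(\<lambda>x. real (?T (min x (xs i)))) \<in> borel_measurable borel"
    by (rule borel_measurable_mono)
  then have "(\<lambda>x. nat \<lfloor>real (?T (min x (xs i)))\<rfloor>) \<in> borel \<rightarrow>\<^sub>M count_space UNIV"
    by measurable
  then have [measurable]: "(\<lambda>x. ?T (min x (xs i))) \<in> borel \<rightarrow>\<^sub>M count_space UNIV"
    by simp
  note [measurable] = insert.IH
  have "?T = (\<lambda>x. if xs i < x then max_min_crossings I x else ?T (min x (xs i)))"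
    by (auto simp: max_min_crossings_insert_right min_def)
  also have "\<dots> \<in> borel \<rightarrow>\<^sub>M count_space UNIV"
    by measurable
  finally show ?case .
qed

section \<open>The balance of areas\<close>

text \<open>It suffices to compare lengths level by level. A level that is present at \<open>c\<close> is present
  all the way from \<open>c\<close> to \<open>c'\<close>, a distance \<open>c' - c\<close>, and has lost at
  least \<open>(\<beta> - \<alpha>) (c' - c)\<close>. A level that is absent at \<open>c\<close> has lost its whole length \<open>L\<close> and was
  present on a distance of at most \<open>L / (\<beta> - \<alpha>)\<close>.\<close>

lemma integral_decrease_to_left:
  assumes "finite I" "c \<le> c'" and gates: "\<And>i. i \<in> I \<Longrightarrow> c' \<le> xs i"
  shows "ennreal (\<beta> - \<alpha>) * (\<integral>\<^sup>+x\<in>{c<..c'}. of_nat (max_min_crossings I x) \<partial>lborel)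
      + (\<integral>\<^sup>+y. of_nat (min_crossings I c y) \<partial>lborel)
    \<le> (\<integral>\<^sup>+y. of_nat (min_crossings I c' y) \<partial>lborel)"
proof -
  let ?A = "\<lambda>k c. {y. k \<le> min_crossings I c y}"
  let ?S = "\<lambda>k. {c<..c'} \<inter> {x. k \<le> max_min_crossings I x}"
  note [measurable] = max_min_crossings_measurable[OF \<open>finite I\<close>]
  have S_meas: "?S k \<in> sets lborel" for k
    by measurable
  have integral_min: "(\<integral>\<^sup>+y. of_nat (min_crossings I b y) \<partial>lborel)
      = (\<Sum>k=1..card I. emeasure lborel (?A k b))" if "b \<le> c'" for b
  proof -
    have "compact (?A k b)" if "1 \<le> k" for k
      using compact_level[OF \<open>finite I\<close> that] gates \<open>b \<le> c'\<close> by (meson order_trans)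
    then show ?thesis
      using nn_integral_nat_layers[of "min_crossings I b" "card I" UNIV lborel]
        min_crossings_le_card[OF \<open>finite I\<close>] by (simp add: borel_compact)
  qed
  have level: "ennreal (\<beta> - \<alpha>) * emeasure lborel (?S k) + emeasure lborel (?A k c)
      \<le> emeasure lborel (?A k c')" if "1 \<le> k" for k
  proof (cases "k \<le> max_min_crossings I c")
    case True
    have "emeasure lborel (?S k) \<le> emeasure lborel {c<..c'}"
      by (rule emeasure_mono) auto
    then have "ennreal (\<beta> - \<alpha>) * emeasure lborel (?S k) \<le> ennreal (\<beta> - \<alpha>) * ennreal (c' - c)"
      using \<open>c \<le> c'\<close> by (intro mult_left_mono) auto
    also have "\<dots> = ennreal ((\<beta> - \<alpha>) * (c' - c))"
      using slopes \<open>c \<le> c'\<close> by (simp add: ennreal_mult)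
    finally show ?thesis
      using emeasure_level_later[OF \<open>finite I\<close> \<open>1 \<le> k\<close> \<open>c \<le> c'\<close> gates True]
      by (meson add_right_mono order_trans)
  next
    case False
    then have "?A k c = {}"
      by (simp add: le_max_min_crossings_iff[OF \<open>finite I\<close>])
    obtain L where "0 \<le> L" and L: "emeasure lborel (?A k c') = ennreal L"
      using emeasure_level_finite[OF \<open>finite I\<close> \<open>1 \<le> k\<close> gates] by blast
    have "?S k \<subseteq> {c' - L / (\<beta> - \<alpha>)..c'}"
      using level_extinct[OF \<open>finite I\<close> \<open>1 \<le> k\<close> _ gates _ L \<open>0 \<le> L\<close>] by auto
    then have "emeasure lborel (?S k) \<le> emeasure lborel {c' - L / (\<beta> - \<alpha>)..c'}"
      by (rule emeasure_mono) simp
    also have "\<dots> = ennreal (L / (\<beta> - \<alpha>))"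
      using slopes \<open>0 \<le> L\<close> by simp
    finally have "ennreal (\<beta> - \<alpha>) * emeasure lborel (?S k)
        \<le> ennreal (\<beta> - \<alpha>) * ennreal (L / (\<beta> - \<alpha>))"
      by (rule mult_left_mono) simp
    also have "\<dots> = ennreal L"
      using slopes \<open>0 \<le> L\<close> by (simp flip: ennreal_mult)
    finally show ?thesis
      using L \<open>?A k c = {}\<close> by simp
  qed
  have "(\<integral>\<^sup>+x\<in>{c<..c'}. of_nat (max_min_crossings I x) \<partial>lborel)
      = (\<Sum>k=1..card I. emeasure lborel (?S k))"
    using S_meas max_min_crossings_le_card[OF \<open>finite I\<close>] by (intro nn_integral_nat_layers) auto
  then have "ennreal (\<beta> - \<alpha>) * (\<integral>\<^sup>+x\<in>{c<..c'}. of_nat (max_min_crossings I x) \<partial>lborel)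
      + (\<integral>\<^sup>+y. of_nat (min_crossings I c y) \<partial>lborel)
    = (\<Sum>k=1..card I. ennreal (\<beta> - \<alpha>) * emeasure lborel (?S k) + emeasure lborel (?A k c))"
    using integral_min[OF \<open>c \<le> c'\<close>] by (simp add: sum_distrib_left sum.distrib)
  also have "\<dots> \<le> (\<Sum>k=1..card I. emeasure lborel (?A k c'))"
    by (rule sum_mono) (use level in auto)
  finally show ?thesis using integral_min[of c'] by simp
qed

lemma min_crossings_measurable:
  assumes "finite I" "\<And>i. i \<in> I \<Longrightarrow> c \<le> xs i"
  shows "(\<lambda>y. of_nat (min_crossings I c y) :: ennreal) \<in> borel_measurable borel"
proof -
  have levels: "{y. k \<le> min_crossings I c y} \<in> sets borel" for k
    using borel_compact[OF compact_level[OF assms(1) _ assms(2)], of k] by (cases "k = 0") auto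
  then have "(\<lambda>y. real (min_crossings I c y)) -` {a<..} \<in> sets borel" for a
  proof (cases "a < 0")
    case False
    then have "(\<lambda>y. real (min_crossings I c y)) -` {a<..} = {y. nat \<lfloor>a\<rfloor> + 1 \<le> min_crossings I c y}"
      by auto linarith+
    then show ?thesis using levels by simp
  qed (simp add: vimage_def)
  then have "(\<lambda>y. real (min_crossings I c y)) \<in> borel_measurable borel"
    by (intro borel_measurableI_greater) (simp add: vimage_def)
  then show ?thesis by (simp add: ennreal_of_nat_eq_real_of_nat)
qed

text \<open>The term with \<open>min_crossings\<close> is the area still available at \<open>c\<close>; the induction over the
  gates needs it, since the next gate to the left adds to it.\<close>

lemma integral_right_of_le_heights:
  assumes "finite I" "\<And>i. i \<in> I \<Longrightarrow> c \<le> xs i"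
  shows "ennreal (\<beta> - \<alpha>) * (\<integral>\<^sup>+x\<in>{c<..}. of_nat (max_min_crossings I x) \<partial>lborel)
      + (\<integral>\<^sup>+y. of_nat (min_crossings I c y) \<partial>lborel)
    \<le> (\<Sum>i\<in>I. ennreal (M i - m i))"
  using assms
proof (induction I arbitrary: c rule: finite_ranking_induct[where f = "\<lambda>i. - xs i"])
  case empty
  have "max_min_crossings {} x = 0" "min_crossings {} c y = 0" for x y
    using max_min_crossings_le_card[of "{}"] min_crossings_le_card[of "{}"] by auto
  then show ?case by simp
next
  case (insert i I)
  show ?case
  proof (cases "i \<in> I")
    case True
    then show ?thesis using insert by (simp add: insert_absorb)
  next
    case False
    let ?J = "insert i I" and ?b = "ennreal (\<beta> - \<alpha>)"
    let ?T = "\<lambda>S I. \<integral>\<^sup>+x\<in>S. of_nat (max_min_crossings I x) \<partial>lborel"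
    let ?t = "\<lambda>I c. \<integral>\<^sup>+y. of_nat (min_crossings I c y) \<partial>lborel"
    have gates: "xs i \<le> xs j" if "j \<in> ?J" for j
      using insert.hyps(2) that by auto
    have "c \<le> xs i" using insert.prems by simp
    have "finite ?J" using insert.hyps(1) by simp
    note [measurable] = max_min_crossings_measurable[OF \<open>finite ?J\<close>]
      max_min_crossings_measurable[OF insert.hyps(1)]
    have "{c<..} = {c<..xs i} \<union> {xs i<..}"
      using \<open>c \<le> xs i\<close> by auto
    then have "?T {c<..} ?J = ?T ({c<..xs i} \<union> {xs i<..}) ?J"
      by simp
    also have "\<dots> = ?T {c<..xs i} ?J + ?T {xs i<..} ?J"
      by (rule nn_integral_disjoint_pair) auto
    also have "?T {xs i<..} ?J = ?T {xs i<..} I"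
      by (intro nn_integral_cong) (auto simp: max_min_crossings_insert_right split: split_indicator)
    finally have "?b * ?T {c<..} ?J + ?t ?J c
        = ?b * ?T {xs i<..} I + (?b * ?T {c<..xs i} ?J + ?t ?J c)"
      by (simp add: distrib_left ac_simps)
    also have "\<dots> \<le> ?b * ?T {xs i<..} I + ?t ?J (xs i)"
      using integral_decrease_to_left[OF \<open>finite ?J\<close> \<open>c \<le> xs i\<close> gates] by (rule add_left_mono)
    also have "?t ?J (xs i) = (\<integral>\<^sup>+y. of_nat (min_crossings I (xs i) y) + indicator {m i..M i} y \<partial>lborel)"
      using False insert.hyps(1)
      by (intro nn_integral_cong) (auto simp: min_crossings_insert_at split: split_indicator)
    also have "\<dots> = ?t I (xs i) + ennreal (M i - m i)"
      using min_crossings_measurable[OF insert.hyps(1), of "xs i"] gates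
      by (subst nn_integral_add) (auto simp: emeasure_lborel_Icc_eq ennreal_neg)
    also have "?b * ?T {xs i<..} I + (?t I (xs i) + ennreal (M i - m i))
        \<le> (\<Sum>i\<in>I. ennreal (M i - m i)) + ennreal (M i - m i)"
      using insert.IH[of "xs i"] gates by (simp add: add.assoc[symmetric] add_right_mono)
    also have "\<dots> = (\<Sum>i\<in>?J. ennreal (M i - m i))"
      using False insert.hyps(1) by (simp add: add.commute)
    finally show ?thesis .
  qed
qed

text \<open>Far enough to the left of all gates the player can always avoid every one of them, so the
  integral over a half-line is already the whole integral.\<close>

lemma integral_le_heights:
  assumes "finite I"
  shows "ennreal (\<beta> - \<alpha>) * (\<integral>\<^sup>+x. of_nat (max_min_crossings I x) \<partial>lborel)
    \<le> (\<Sum>i\<in>I. ennreal (M i - m i))"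
proof -
  \<comment> \<open>The element \<open>0\<close> is only there to have a minimum when there are no gates.\<close>
  define c where "c = Min (insert 0 (xs ` I))"
  have gates: "c \<le> xs i" if "i \<in> I" for i
    using that assms by (simp add: c_def)
  obtain L where "0 \<le> L" and L: "emeasure lborel {y. 1 \<le> min_crossings I c y} = ennreal L"
    using emeasure_level_finite[OF assms order_refl gates] by blast
  \<comment> \<open>The \<open>1\<close> makes the inequality \<open>x < c - L / (\<beta> - \<alpha>)\<close> strict for all \<open>x \<le> b\<close>.\<close>
  define b where "b = c - L / (\<beta> - \<alpha>) - 1"
  have "0 \<le> L / (\<beta> - \<alpha>)"
    using slopes \<open>0 \<le> L\<close> by simp
  then have "b \<le> c"
    by (simp add: b_def)
  have zero: "max_min_crossings I x = 0" if "x \<le> b" for x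
  proof (rule ccontr)
    assume "max_min_crossings I x \<noteq> 0"
    then have "c - L / (\<beta> - \<alpha>) \<le> x"
      using level_extinct[OF assms order_refl _ gates _ L \<open>0 \<le> L\<close>] that \<open>b \<le> c\<close> by simp
    then show False using that by (simp add: b_def)
  qed
  have "(\<integral>\<^sup>+x. of_nat (max_min_crossings I x) \<partial>lborel)
      = (\<integral>\<^sup>+x\<in>{b<..}. of_nat (max_min_crossings I x) \<partial>lborel)"
    using zero by (intro nn_integral_cong) (auto split: split_indicator)
  moreover have "b \<le> xs i" if "i \<in> I" for i
    using gates[OF that] \<open>b \<le> c\<close> by simp
  ultimately show ?thesis
    using integral_right_of_le_heights[OF assms, of b] by (simp add: add_increasing2 order_trans[rotated])
qed

end

theorem theorem1:
  fixes \<alpha> \<beta> :: real and n :: nat and xs m M :: "nat \<Rightarrow> real"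
  assumes "\<alpha> < \<beta>"
    and "\<And>i. i \<in> {1..n} \<Longrightarrow> m i \<le> M i"
  shows "integrable lborel (\<lambda>x. real (max_min_crossed \<alpha> \<beta> n xs m M x)) \<and>
    (LINT x|lborel. real (max_min_crossed \<alpha> \<beta> n xs m M x))
      \<le> 1 / (\<beta> - \<alpha>) * (\<Sum>i = 1..n. M i - m i)"
proof -
  interpret gate_game \<alpha> \<beta> xs m M
    by unfold_locales (rule assms(1))
  define T where "T = max_min_crossings {1..n}"
  have T: "max_min_crossed \<alpha> \<beta> n xs m M = T"
    by (simp add: T_def fun_eq_iff max_min_crossed_def min_crossed_def crossed_def
        max_min_crossings_def min_crossings_def crossings_def)
  define H where "H = (\<Sum>i = 1..n. M i - m i)"
  have "0 \<le> H"
    unfolding H_def using assms(2) by (intro sum_nonneg) auto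
  have "ennreal (\<beta> - \<alpha>) * (\<integral>\<^sup>+x. ennreal (real (T x)) \<partial>lborel) \<le> ennreal H"
    using integral_le_heights[of "{1..n}"] sum_ennreal[of "{1..n}" "\<lambda>i. M i - m i"] assms(2)
    by (simp add: T_def H_def ennreal_of_nat_eq_real_of_nat)
  then have "ennreal (1 / (\<beta> - \<alpha>)) * (ennreal (\<beta> - \<alpha>) * (\<integral>\<^sup>+x. ennreal (real (T x)) \<partial>lborel))
      \<le> ennreal (1 / (\<beta> - \<alpha>)) * ennreal H"
    by (rule mult_left_mono) simp
  moreover have "ennreal (1 / (\<beta> - \<alpha>)) * ennreal (\<beta> - \<alpha>) = 1"
    using assms(1) by (simp flip: ennreal_mult)
  moreover have "ennreal (1 / (\<beta> - \<alpha>)) * ennreal H = ennreal (1 / (\<beta> - \<alpha>) * H)"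
    using assms(1) \<open>0 \<le> H\<close> by (intro ennreal_mult[symmetric]) auto
  ultimately have bound: "(\<integral>\<^sup>+x. ennreal (real (T x)) \<partial>lborel) \<le> ennreal (1 / (\<beta> - \<alpha>) * H)"
    by (simp flip: mult.assoc)
  have [measurable]: "T \<in> borel \<rightarrow>\<^sub>M count_space UNIV"
    unfolding T_def by (rule max_min_crossings_measurable) simp
  have "integrable lborel (\<lambda>x. real (T x))"
    using bound by (intro integrableI_nonneg) (auto intro: le_less_trans)
  moreover have "(LINT x|lborel. real (T x)) \<le> 1 / (\<beta> - \<alpha>) * H"
    using bound assms(1) \<open>0 \<le> H\<close> by (intro integral_real_bounded) auto
  ultimately show ?thesis
    by (simp add: T H_def)
qed

end
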